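(* Let $G$ be an arbitrary graph on $p$ vertices and let $q\ge p$ be an integer. Let $G\vee qK_1$ denote the join of $G$ with an independent set of $q$ vertices. Then for each $1\le k\le p+q-1$, $$s_k(G\vee qK_1)\le e(G\vee qK_1)+\binom{k+1}{2},$$ with equality if and only if $k=p$ and $G\cong K_p$ (in which case $G\vee qK_1$ is a threshold graph with clique number $k+1$).
   Context: All graphs are finite, simple and undirected; $e(H)$ is the number of edges of $H$. For a graph $H$ on $n$ vertices, $L(H)=D(H)-A(H)$ is its Laplacian matrix, with eigenvalues $\mu_1(H)\ge\dots\ge\mu_n(H)$, and $s_k(H)=\sum_{i=1}^k\mu_i(H)$. The join $G_1\vee G_2$ of vertex-disjoint graphs is obtained from their union by adding all edges between $V(G_1)$ and $V(G_2)$; $qK_1$ is the edgeless graph on $q$ vertices; $K_p$ is the complete graph. A threshold graph is a graph built from a single vertex by repeatedly adding a new isolated vertex or a new dominating vertex. *)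

theory Defs
  imports
    "Graph_Theory.Pair_Digraph"
    "Graph_Theory.Digraph_Isomorphism"
    "Jordan_Normal_Form.Char_Poly"
begin

text \<open>
  Finite simple undirected graphs are those \<open>G :: 'a pair_pre_digraph\<close> with \<open>pair_graph G\<close>: an
  undirected edge between \<open>u\<close> and \<open>v\<close> is represented by the two arcs \<open>(u, v)\<close> and \<open>(v, u)\<close>.
  The degree of a vertex is therefore its out-degree.
\<close>

definition edges :: "'a pair_pre_digraph \<Rightarrow> 'a set set" where
  "edges H = {{u, v} |u v. (u, v) \<in> parcs H}"

definition num_edges :: "'a pair_pre_digraph \<Rightarrow> nat" where
  "num_edges H = card (edges H)"

text \<open>
  Matrices are indexed by \<open>0, \<dots>, n - 1\<close>, so we fix some enumeration of the vertices; another
  choice conjugates the matrices by a permutation matrix and does not affect the eigenvalues.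
\<close>

definition vertex_list :: "'a pair_pre_digraph \<Rightarrow> 'a list" where
  "vertex_list H = (SOME xs. distinct xs \<and> set xs = pverts H)"

definition degree_matrix :: "'a pair_pre_digraph \<Rightarrow> real mat" where
  "degree_matrix H = mat (card (pverts H)) (card (pverts H))
     (\<lambda>(i, j). if i = j then real (out_degree (with_proj H) (vertex_list H ! i)) else 0)"

definition adjacency_matrix :: "'a pair_pre_digraph \<Rightarrow> real mat" where
  "adjacency_matrix H = mat (card (pverts H)) (card (pverts H))
     (\<lambda>(i, j). if (vertex_list H ! i, vertex_list H ! j) \<in> parcs H then 1 else 0)"

definition laplacian :: "'a pair_pre_digraph \<Rightarrow> real mat" where
  "laplacian H = degree_matrix H - adjacency_matrix H"

text \<open>
  The eigenvalues with multiplicity, in nonincreasing order. For a graph the Laplacian is a real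
  symmetric matrix, so all roots of its characteristic polynomial are real and this list has
  one entry per vertex. The list is indexed from 0, the eigenvalues \<open>\<mu>\<^sub>i\<close> from 1.
\<close>

definition laplacian_eigenvalues :: "'a pair_pre_digraph \<Rightarrow> real list" where
  "laplacian_eigenvalues H = rev (sorted_list_of_multiset (proots (char_poly (laplacian H))))"

definition laplacian_eigenvalue :: "'a pair_pre_digraph \<Rightarrow> nat \<Rightarrow> real" where
  "laplacian_eigenvalue H i = laplacian_eigenvalues H ! (i - 1)"

definition laplacian_sum :: "nat \<Rightarrow> 'a pair_pre_digraph \<Rightarrow> real" where
  "laplacian_sum k H = (\<Sum>i=1..k. laplacian_eigenvalue H i)"

text \<open>The sum type makes the two vertex sets disjoint.\<close>

definition graph_join ::
    "'a pair_pre_digraph \<Rightarrow> 'b pair_pre_digraph \<Rightarrow> ('a + 'b) pair_pre_digraph" where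
  "graph_join G H =
     \<lparr> pverts = pverts G <+> pverts H,
       parcs = {(Inl u, Inl v) |u v. (u, v) \<in> parcs G}
         \<union> {(Inr u, Inr v) |u v. (u, v) \<in> parcs H}
         \<union> {(Inl u, Inr v) |u v. u \<in> pverts G \<and> v \<in> pverts H}
         \<union> {(Inr v, Inl u) |u v. u \<in> pverts G \<and> v \<in> pverts H} \<rparr>"

definition edgeless_graph :: "nat \<Rightarrow> nat pair_pre_digraph" where
  "edgeless_graph q = \<lparr> pverts = {..<q}, parcs = {} \<rparr>"

definition complete_graph :: "nat \<Rightarrow> nat pair_pre_digraph" where
  "complete_graph p = \<lparr> pverts = {..<p}, parcs = {(u, v). u < p \<and> v < p \<and> u \<noteq> v} \<rparr>"

definition graph_isomorphic :: "'a pair_pre_digraph \<Rightarrow> 'b pair_pre_digraph \<Rightarrow> bool" where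
  "graph_isomorphic G H \<longleftrightarrow> digraph_iso (with_proj G) (with_proj H)"

inductive threshold_graph :: "'a pair_pre_digraph \<Rightarrow> bool" where
  single: "threshold_graph \<lparr> pverts = {v}, parcs = {} \<rparr>"
| isolated: "threshold_graph \<lparr> pverts = insert v (pverts H), parcs = parcs H \<rparr>"
    if "threshold_graph H" and "v \<notin> pverts H"
| dominating: "threshold_graph \<lparr> pverts = insert v (pverts H),
      parcs = parcs H \<union> {v} \<times> pverts H \<union> pverts H \<times> {v} \<rparr>"
    if "threshold_graph H" and "v \<notin> pverts H"

definition clique :: "'a pair_pre_digraph \<Rightarrow> 'a set \<Rightarrow> bool" where
  "clique H C \<longleftrightarrow> C \<subseteq> pverts H \<and> (\<forall>u\<in>C. \<forall>v\<in>C. u \<noteq> v \<longrightarrow> (u, v) \<in> parcs H)"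

definition clique_number :: "'a pair_pre_digraph \<Rightarrow> nat" where
  "clique_number H = Max {card C |C. clique H C}"

end

theory Submission
  imports Defs "Jordan_Normal_Form.Schur_Decomposition"
begin

text \<open>
  A Schur complement shows that, for \<open>p > 0\<close>, the spectrum of \<open>G \<or> qK\<^sub>1\<close> consists of \<open>p + q\<close>, the
  eigenvalues of \<open>G\<close> other than one \<open>0\<close> shifted by \<open>q\<close>, the value \<open>p\<close> with multiplicity \<open>q - 1\<close>,
  and \<open>0\<close>; as \<open>q \<ge> p\<close>, this is already the nonincreasing order. The eigenvalues of \<open>G\<close> lie in
  \<open>[0, p]\<close> and sum to \<open>2 e(G)\<close>. For \<open>k < p\<close> and \<open>j = k - 1\<close>, averaging \<open>s\<^sub>j(G) \<le> j p\<close> and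
  \<open>s\<^sub>j(G) \<le> 2 e(G)\<close> leaves at least the slack \<open>(2 p - k - 1) (p - k) / 2 > 0\<close>. For \<open>k = p + t\<close> the sum is
  explicit, and \<open>e(G) \<le> p (p - 1) / 2\<close> leaves at least \<open>t (t + 1) / 2\<close>, which vanishes only for \<open>t = 0\<close>.
\<close>

section \<open>Block determinants and symmetric matrices\<close>

text \<open>Multiplying on the right by the unipotent block matrix \<open>?N\<close> clears the
  lower left block. A solution \<open>X\<close> of \<open>D * X = C\<close> stands in for the
  inverse of \<open>D\<close> applied to \<open>C\<close>, so no division is involved.\<close>

lemma det_four_block_mat_schur_complement:
  fixes A :: "'a :: idom mat"
  assumes A: "A \<in> carrier_mat n n" and B: "B \<in> carrier_mat n m"
    and C: "C \<in> carrier_mat m n" and D: "D \<in> carrier_mat m m"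
    and X: "X \<in> carrier_mat m n" and DX: "D * X = C"
  shows "det (four_block_mat A B C D) = det (A - B * X) * det D"
proof -
  let ?M = "four_block_mat A B C D"
  let ?N = "four_block_mat (1\<^sub>m n) (0\<^sub>m n m) (- X) (1\<^sub>m m)"
  have M: "?M \<in> carrier_mat (n + m) (n + m)" and N: "?N \<in> carrier_mat (n + m) (n + m)"
    using A D by auto
  have detN: "det ?N = 1"
    by (subst det_four_block_mat_upper_right_zero[of _ n _ m]) (use X in auto)
  have blk: "?M * ?N = four_block_mat (A - B * X) B (0\<^sub>m m n) D"
  proof -
    have "?M * ?N = four_block_mat (A * 1\<^sub>m n + B * - X) (A * 0\<^sub>m n m + B * 1\<^sub>m m)
        (C * 1\<^sub>m n + D * - X) (C * 0\<^sub>m n m + D * 1\<^sub>m m)"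
      by (rule mult_four_block_mat[OF A B C D]) (use X in auto)
    moreover have "A * 1\<^sub>m n + B * - X = A - B * X"
      using A B X by (auto simp: minus_add_uminus_mat[of _ n n])
    moreover have "C * 1\<^sub>m n + D * - X = 0\<^sub>m m n"
      using C D X DX by (auto intro!: eq_matI)
    ultimately show ?thesis using A B C D by simp
  qed
  have "det ?M = det ?M * det ?N" by (simp add: detN)
  also have "\<dots> = det (?M * ?N)" by (rule det_mult[OF M N, symmetric])
  also have "\<dots> = det (A - B * X) * det D"
    unfolding blk by (rule det_four_block_mat_lower_left_zero) (use A B X D in auto)
  finally show ?thesis .
qed

text \<open>Sylvester's determinant identity: both sides are the determinant of \<open>?M\<close>,
  once by a Schur complement (column operation) and once by a row operation. It turns a rank-one
  perturbation into a 1-by-1 determinant.\<close>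

lemma det_one_minus_mult_commute:
  fixes A :: "'a :: idom mat"
  assumes A: "A \<in> carrier_mat n m" and B: "B \<in> carrier_mat m n"
  shows "det (1\<^sub>m n - A * B) = det (1\<^sub>m m - B * A)"
proof -
  let ?M = "four_block_mat (1\<^sub>m n) A B (1\<^sub>m m)"
  let ?N = "four_block_mat (1\<^sub>m n) (0\<^sub>m n m) (- B) (1\<^sub>m m)"
  have M: "?M \<in> carrier_mat (n + m) (n + m)" and N: "?N \<in> carrier_mat (n + m) (n + m)"
    by auto
  have detN: "det ?N = 1"
    by (subst det_four_block_mat_upper_right_zero[of _ n _ m]) (use B in auto)
  have blk: "?N * ?M = four_block_mat (1\<^sub>m n) A (0\<^sub>m m n) (1\<^sub>m m - B * A)"
  proof -
    have "?N * ?M = four_block_mat (1\<^sub>m n * 1\<^sub>m n + 0\<^sub>m n m * B) (1\<^sub>m n * A + 0\<^sub>m n m * 1\<^sub>m m)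
        (- B * 1\<^sub>m n + 1\<^sub>m m * B) (- B * A + 1\<^sub>m m * 1\<^sub>m m)"
      by (rule mult_four_block_mat) (use A B in auto)
    moreover have "- B * A + 1\<^sub>m m * 1\<^sub>m m = 1\<^sub>m m - B * A"
      using A B by (auto intro!: eq_matI)
    moreover have "- B * 1\<^sub>m n + 1\<^sub>m m * B = 0\<^sub>m m n"
      using B by (simp add: uminus_l_inv_mat)
    ultimately show ?thesis using A B by simp
  qed
  have "det (1\<^sub>m n - A * B) = det ?M"
    by (subst det_four_block_mat_schur_complement[OF _ A B _ B]) (use A B in auto)
  also have "\<dots> = det ?N * det ?M" by (simp add: detN)
  also have "\<dots> = det (?N * ?M)" by (rule det_mult[OF N M, symmetric])
  also have "\<dots> = det (1\<^sub>m m - B * A)"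
    unfolding blk by (subst det_four_block_mat_lower_left_zero[of _ n _ m]) (use A B in auto)
  finally show ?thesis .
qed

text \<open>The all-ones blocks only see \<open>M\<close> through its action on the all-ones vector, an eigenvector for \<open>z\<close>.\<close>

lemma det_join_block:
  fixes M :: "'a :: field mat"
  assumes M: "M \<in> carrier_mat p p"
    and rows: "\<And>i. i < p \<Longrightarrow> (\<Sum>j<p. M $$ (i, j)) = z"
    and z: "z \<noteq> 0" and w: "w \<noteq> 0"
  shows "det (four_block_mat M (mat p q (\<lambda>_. 1)) (mat q p (\<lambda>_. 1)) (w \<cdot>\<^sub>m 1\<^sub>m q)) * (z * w)
    = det M * w ^ q * (z * w - of_nat p * of_nat q)"
proof -
  let ?X = "mat q p (\<lambda>_. 1 / w)"
  let ?U = "mat p 1 (\<lambda>_. of_nat q / (z * w))" and ?V = "mat 1 p (\<lambda>_. 1)"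
  \<comment> \<open>The Schur complement subtracts \<open>q / w\<close> from every entry of
    \<open>M\<close>. Since the rows of \<open>M\<close> sum to \<open>z\<close>, the constant
    rank-one matrix \<open>?U * ?V\<close> with entries \<open>q / (z * w)\<close> is mapped by
    \<open>M\<close> to exactly that, so \<open>M\<close> factors out.\<close>
  have split: "M - mat p q (\<lambda>_. 1) * ?X = M * (1\<^sub>m p - ?U * ?V)"
  proof (rule eq_matI)
    fix i j assume "i < dim_row (M * (1\<^sub>m p - ?U * ?V))" "j < dim_col (M * (1\<^sub>m p - ?U * ?V))"
    then have ij: "i < p" "j < p" using M by auto
    have "(M * (1\<^sub>m p - ?U * ?V)) $$ (i, j) =
        (\<Sum>k<p. M $$ (i, k) * ((if k = j then 1 else 0) - of_nat q / (z * w)))"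
      using ij M by (auto simp: scalar_prod_def atLeast0LessThan intro!: sum.cong)
    also have "\<dots> = (\<Sum>k<p. if k = j then M $$ (i, k) else 0)
        - (\<Sum>k<p. M $$ (i, k)) * (of_nat q / (z * w))"
      by (simp add: right_diff_distrib sum_subtractf sum_distrib_right sum_divide_distrib
          if_distrib[of "\<lambda>x. _ * x"] cong: if_cong)
    also have "\<dots> = M $$ (i, j) - of_nat q / w"
      using ij z by (simp add: rows)
    finally show "(M - mat p q (\<lambda>_. 1) * ?X) $$ (i, j) = (M * (1\<^sub>m p - ?U * ?V)) $$ (i, j)"
      using ij M by (simp add: scalar_prod_def)
  qed (use M in auto)
  have "w \<cdot>\<^sub>m 1\<^sub>m q * ?X = w \<cdot>\<^sub>m (1\<^sub>m q * ?X)"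
    by (rule mult_smult_assoc_mat) auto
  then have DX: "w \<cdot>\<^sub>m 1\<^sub>m q * ?X = mat q p (\<lambda>_. 1)"
    using w by (simp) (auto intro!: eq_matI)
  have "det (1\<^sub>m p - ?U * ?V) = det (1\<^sub>m 1 - ?V * ?U)"
    by (rule det_one_minus_mult_commute) auto
  also have "\<dots> = 1 - of_nat p * of_nat q / (z * w)"
    by (subst det_single) (auto simp: scalar_prod_def)
  finally have d: "det (1\<^sub>m p - ?U * ?V) = 1 - of_nat p * of_nat q / (z * w)" .
  have "det (four_block_mat M (mat p q (\<lambda>_. 1)) (mat q p (\<lambda>_. 1)) (w \<cdot>\<^sub>m 1\<^sub>m q))
      = det (M * (1\<^sub>m p - ?U * ?V)) * det (w \<cdot>\<^sub>m 1\<^sub>m q)"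
    by (subst det_four_block_mat_schur_complement[OF M _ _ _ _ DX]) (auto simp: split)
  also have "\<dots> = det M * (1 - of_nat p * of_nat q / (z * w)) * w ^ q"
    by (subst det_mult[OF M]) (auto simp: d det_smult simp del: One_nat_def)
  finally show ?thesis using z w by (simp add: field_simps)
qed

text \<open>Changing the enumeration conjugates the matrix by a permutation matrix. This frees the
  Laplacian spectrum from the arbitrary choice of vertex order.\<close>

lemma char_poly_reorder:
  fixes f :: "'b \<Rightarrow> 'b \<Rightarrow> 'a :: comm_ring_1"
  assumes xs: "distinct xs" and ys: "distinct ys" and eq: "set xs = set ys"
  defines "F \<equiv> \<lambda>zs. mat (length zs) (length zs) (\<lambda>(i, j). f (zs ! i) (zs ! j))"
  shows "char_poly (F xs) = char_poly (F ys)"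
proof -
  define n where "n = length xs"
  have ny: "length ys = n"
    using xs ys eq by (metis distinct_card n_def)
  \<comment> \<open>\<open>T as bs\<close> is the permutation matrix matching positions in
    \<open>as\<close> with positions in \<open>bs\<close>; its inverse is
    \<open>T bs as\<close>.\<close>
  define T where "T = (\<lambda>as (bs :: 'b list). mat n n (\<lambda>(i, j). if as ! i = bs ! j then 1 else 0 :: 'a))"
  \<comment> \<open>Distinctness turns a sum over positions into one over values, where a single
    term survives. All matrix products below reduce to this.\<close>
  have pick: "(\<Sum>k = 0..<n. (if a = as ! k then h (as ! k) else 0)) = h a"
    if "a \<in> set as" "distinct as" "length as = n" for a h and as :: "'b list"
  proof -
    have "(\<Sum>k = 0..<n. (if a = as ! k then h (as ! k) else 0)) = (\<Sum>b\<in>set as. if a = b then h b else 0)"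
      by (rule sum.reindex_bij_betw)
        (use bij_betw_nth[OF that(2) refl refl] that(3) in \<open>simp add: atLeast0LessThan\<close>)
    then show ?thesis using that by simp
  qed
  have inv: "T as bs * T bs as = 1\<^sub>m n"
    if "distinct as" "distinct bs" "set as = set bs" "length as = n" "length bs = n" for as bs :: "'b list"
  proof (rule eq_matI)
    fix i j assume "i < dim_row (1\<^sub>m n :: 'a mat)" "j < dim_col (1\<^sub>m n :: 'a mat)"
    then have ij: "i < n" "j < n" by auto
    have "(T as bs * T bs as) $$ (i, j)
        = (\<Sum>k = 0..<n. (if as ! i = bs ! k then (if bs ! k = as ! j then 1 else 0) else 0))"
      using ij by (auto simp: T_def scalar_prod_def intro!: sum.cong)
    also have "\<dots> = (if as ! i = as ! j then 1 else 0)"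
      by (rule pick) (use that ij nth_mem[of i as] in auto)
    finally show "(T as bs * T bs as) $$ (i, j) = 1\<^sub>m n $$ (i, j)"
      using ij that by (simp add: nth_eq_iff_index_eq)
  qed (auto simp: T_def)
  have conj: "F xs = T xs ys * F ys * T ys xs"
  proof (rule eq_matI)
    fix i j assume "i < dim_row (T xs ys * F ys * T ys xs)" "j < dim_col (T xs ys * F ys * T ys xs)"
    then have ij: "i < n" "j < n" by (auto simp: T_def)
    have 1: "(T xs ys * F ys) $$ (i, k) = f (xs ! i) (ys ! k)" if "k < n" for k
    proof -
      have "(T xs ys * F ys) $$ (i, k)
          = (\<Sum>l = 0..<n. (if xs ! i = ys ! l then f (ys ! l) (ys ! k) else 0))"
        using ij that by (auto simp: T_def F_def ny scalar_prod_def intro!: sum.cong)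
      also have "\<dots> = f (xs ! i) (ys ! k)"
        using ij eq ys ny by (subst pick) (auto simp flip: eq simp: n_def)
      finally show ?thesis .
    qed
    have "(T xs ys * F ys * T ys xs) $$ (i, j)
        = (\<Sum>k = 0..<n. (T xs ys * F ys) $$ (i, k) * T ys xs $$ (k, j))"
      using ij by (subst times_mat_def) (simp add: scalar_prod_def T_def F_def ny)
    also have "\<dots> = (\<Sum>k = 0..<n. (if xs ! j = ys ! k then f (xs ! i) (ys ! k) else 0))"
      using ij by (intro sum.cong) (auto simp: 1, auto simp: T_def)
    also have "\<dots> = f (xs ! i) (xs ! j)"
      using ij eq ys ny by (subst pick) (auto simp flip: eq simp: n_def)
    finally show "F xs $$ (i, j) = (T xs ys * F ys * T ys xs) $$ (i, j)"
      using ij by (simp add: F_def n_def)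
  qed (auto simp: F_def T_def n_def)
  have "similar_mat (F xs) (F ys)"
  proof (rule similar_matI)
    show "{F xs, F ys, T xs ys, T ys xs} \<subseteq> carrier_mat n n"
      by (simp add: F_def T_def n_def ny[unfolded n_def])
    show "T xs ys * T ys xs = 1\<^sub>m n" "T ys xs * T xs ys = 1\<^sub>m n"
      by (rule inv; use xs ys eq ny in \<open>simp add: n_def\<close>)+
  qed (rule conj)
  then show ?thesis by (rule char_poly_similar)
qed

section \<open>Real spectrum and trace\<close>

text \<open>The Hermitian form \<open>Q\<close> at an eigenvector equals its own conjugate by
  symmetry of \<open>A\<close>, and it is \<open>a\<close> times the nonzero real squared norm
  \<open>S\<close>.\<close>

lemma symmetric_real_eigenvalue:
  assumes A: "(A :: real mat) \<in> carrier_mat n n"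
    and sym: "\<And>i j. i < n \<Longrightarrow> j < n \<Longrightarrow> A $$ (i, j) = A $$ (j, i)"
    and ev: "eigenvalue (map_mat complex_of_real A) a"
  shows "a \<in> \<real>"
proof -
  let ?A = "map_mat complex_of_real A"
  obtain v where v: "v \<in> carrier_vec n" "v \<noteq> 0\<^sub>v n" "?A *\<^sub>v v = a \<cdot>\<^sub>v v"
    using ev A by (auto simp: eigenvalue_def eigenvector_def)
  have row: "(\<Sum>j<n. of_real (A $$ (i, j)) * v $ j) = a * v $ i" if "i < n" for i
  proof -
    have "(?A *\<^sub>v v) $ i = (\<Sum>j<n. of_real (A $$ (i, j)) * v $ j)"
      using that A v(1) by (auto simp: scalar_prod_def atLeast0LessThan intro!: sum.cong)
    then show ?thesis using v that by simp
  qed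
  define S where "S = (\<Sum>i<n. (cmod (v $ i))\<^sup>2)"
  define Q where "Q = (\<Sum>i<n. \<Sum>j<n. of_real (A $$ (i, j)) * v $ j * cnj (v $ i))"
  have "Q = (\<Sum>i<n. (\<Sum>j<n. of_real (A $$ (i, j)) * v $ j) * cnj (v $ i))"
    by (simp add: Q_def sum_distrib_right)
  also have "\<dots> = a * of_real S"
    by (simp add: row S_def sum_distrib_left mult.assoc complex_norm_square flip: of_real_power)
  finally have Qa: "Q = a * of_real S" .
  have "cnj Q = (\<Sum>i<n. \<Sum>j<n. of_real (A $$ (j, i)) * v $ i * cnj (v $ j))"
    by (auto simp: Q_def sym algebra_simps intro!: sum.cong)
  also have "\<dots> = Q" unfolding Q_def by (rule sum.swap)
  finally have "cnj a * of_real S = a * of_real S" by (simp add: Qa)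
  moreover have "S \<noteq> 0"
  proof
    assume "S = 0"
    then have "\<forall>i<n. v $ i = 0" by (simp add: S_def sum_nonneg_eq_0_iff)
    then have "v = 0\<^sub>v n" using v(1) by (intro eq_vecI) auto
    with v(2) show False by simp
  qed
  ultimately show ?thesis by (simp add: Reals_cnj_iff)
qed

text \<open>The polynomial splits over the complex numbers, its roots are real by the previous
  lemma, and the embedding of real into complex polynomials is injective, so the factorization
  descends.\<close>

lemma symmetric_real_char_poly_splits:
  assumes A: "(A :: real mat) \<in> carrier_mat n n"
    and sym: "\<And>i j. i < n \<Longrightarrow> j < n \<Longrightarrow> A $$ (i, j) = A $$ (j, i)"
  obtains es where "char_poly A = (\<Prod>a\<leftarrow>es. [:- a, 1:])" "length es = n"
proof -
  let ?A = "map_mat complex_of_real A"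
  interpret cp: map_poly_inj_comm_ring_hom complex_of_real ..
  have A': "?A \<in> carrier_mat n n" using A by simp
  obtain as where as: "char_poly ?A = (\<Prod>a\<leftarrow>as. [:- a, 1:])" "length as = n"
    using char_poly_factorized[OF A'] by blast
  have re: "of_real (Re a) = a" if "a \<in> set as" for a
  proof -
    have "poly (char_poly ?A) a = 0"
      unfolding as(1) using that by (auto simp: poly_prod_list prod_list_zero_iff)
    then have "eigenvalue ?A a" by (simp add: eigenvalue_root_char_poly[OF A'])
    then show ?thesis using symmetric_real_eigenvalue[OF A sym] by simp
  qed
  have "map_poly complex_of_real (char_poly A) = char_poly ?A"
    by (rule of_real_hom.char_poly_hom[OF A, symmetric])
  also have "\<dots> = (\<Prod>a\<leftarrow>map Re as. map_poly complex_of_real [:- a, 1:])"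
    unfolding as(1) using re by (auto simp: o_def intro!: arg_cong[of _ _ prod_list])
  also have "\<dots> = map_poly complex_of_real (\<Prod>a\<leftarrow>map Re as. [:- a, 1:])"
    by (simp add: cp.hom_prod_list o_def)
  finally have "char_poly A = (\<Prod>a\<leftarrow>map Re as. [:- a, 1:])" by simp
  then show ?thesis using that[of "map Re as"] as(2) by simp
qed

text \<open>Invariance of the trace: cyclicity moves \<open>Q\<close> in front of
  \<open>P * B\<close>, where it cancels \<open>P\<close>.\<close>

lemma sum_diag_similar_mat_wit:
  fixes A :: "'a :: comm_ring_1 mat"
  assumes A: "A \<in> carrier_mat n n" and sim: "similar_mat_wit A B P Q"
  shows "(\<Sum>i<n. A $$ (i, i)) = (\<Sum>i<n. B $$ (i, i))"
proof -
  note w = similar_mat_witD2[OF A sim]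
  have comm: "(\<Sum>i<n. (X * Y) $$ (i, i)) = (\<Sum>i<n. (Y * X) $$ (i, i))"
    if X: "X \<in> carrier_mat n n" and Y: "Y \<in> carrier_mat n n" for X Y :: "'a mat"
  proof -
    have "(\<Sum>i<n. (X * Y) $$ (i, i)) = (\<Sum>i<n. \<Sum>j<n. X $$ (i, j) * Y $$ (j, i))"
      using X Y by (auto simp: scalar_prod_def atLeast0LessThan intro!: sum.cong)
    also have "\<dots> = (\<Sum>j<n. \<Sum>i<n. X $$ (i, j) * Y $$ (j, i))" by (rule sum.swap)
    also have "\<dots> = (\<Sum>i<n. (Y * X) $$ (i, i))"
      using X Y by (auto simp: scalar_prod_def atLeast0LessThan mult.commute intro!: sum.cong)
    finally show ?thesis .
  qed
  have "(\<Sum>i<n. A $$ (i, i)) = (\<Sum>i<n. (Q * (P * B)) $$ (i, i))"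
    unfolding w(3) by (rule comm) (use w in auto)
  also have "Q * (P * B) = B"
    using w by (simp flip: assoc_mult_mat[of Q n n P n B n])
  finally show ?thesis .
qed

text \<open>Schur decomposition gives a similar matrix with diagonal \<open>es\<close>, and
  similarity preserves the trace.\<close>

lemma sum_list_eigenvalues:
  fixes A :: "'a :: conjugatable_ordered_field mat"
  assumes A: "A \<in> carrier_mat n n" and es: "char_poly A = (\<Prod>a\<leftarrow>es. [:- a, 1:])"
  shows "sum_list es = (\<Sum>i<n. A $$ (i, i))"
proof -
  obtain B P Q where "schur_decomposition A es = (B, P, Q)"
    by (cases "schur_decomposition A es")
  from schur_decomposition[OF A es this]
  have sim: "similar_mat_wit A B P Q" and d: "diag_mat B = es" by auto
  have "B \<in> carrier_mat n n" using similar_mat_witD2[OF A sim] by simp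
  then have "sum_list es = (\<Sum>i<n. B $$ (i, i))"
    unfolding d[symmetric] by (simp add: diag_mat_def sum_list_sum_nth atLeast0LessThan)
  then show ?thesis using sum_diag_similar_mat_wit[OF A sim] by simp
qed

section \<open>Laplacian spectra\<close>

text \<open>Entries are indexed by vertices rather than positions, so that one function serves every
  enumeration and row sums become sums over neighbours.\<close>

definition laplacian_entry :: "'a pair_pre_digraph \<Rightarrow> 'a \<Rightarrow> 'a \<Rightarrow> real" where
  "laplacian_entry H u v =
    (if u = v then real (card {w. (u, w) \<in> parcs H}) else if (u, v) \<in> parcs H then - 1 else 0)"

definition laplacian_wrt :: "'a pair_pre_digraph \<Rightarrow> 'a list \<Rightarrow> real mat" where
  "laplacian_wrt H xs = mat (length xs) (length xs) (\<lambda>(i, j). laplacian_entry H (xs ! i) (xs ! j))"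

lemma laplacian_wrt_carrier [simp]: "laplacian_wrt H xs \<in> carrier_mat (length xs) (length xs)"
  by (simp add: laplacian_wrt_def)

lemma pair_graphD:
  assumes "pair_graph H"
  shows "finite (pverts H)" "finite (parcs H)"
    "\<And>u v. (u, v) \<in> parcs H \<Longrightarrow> u \<in> pverts H"
    "\<And>u v. (u, v) \<in> parcs H \<Longrightarrow> v \<in> pverts H"
    "\<And>u v. (u, v) \<in> parcs H \<Longrightarrow> (v, u) \<in> parcs H"
    "\<And>u. (u, u) \<notin> parcs H"
proof -
  interpret pair_graph H by fact
  show "finite (pverts H)" "finite (parcs H)"
    by (rule pair_finite_verts, rule pair_finite_arcs)
  show "u \<in> pverts H" "v \<in> pverts H" if "(u, v) \<in> parcs H" for u v
    using that by (auto dest: wellformed')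
  show "(v, u) \<in> parcs H" if "(u, v) \<in> parcs H" for u v
    using that by (rule arcs_symmetric)
  show "(u, u) \<notin> parcs H" for u
    using pair_no_loops by force
qed

lemma vertex_list:
  assumes "finite (pverts H)"
  shows "distinct (vertex_list H)" "set (vertex_list H) = pverts H"
proof -
  have "distinct (vertex_list H) \<and> set (vertex_list H) = pverts H"
    unfolding vertex_list_def by (rule someI_ex) (use finite_distinct_list[OF assms] in auto)
  then show "distinct (vertex_list H)" "set (vertex_list H) = pverts H" by auto
qed

lemma laplacian_eq_laplacian_wrt:
  assumes H: "pair_graph H"
  shows "laplacian H = laplacian_wrt H (vertex_list H)"
proof -
  note vl = vertex_list[OF pair_graphD(1)[OF H]]
  have len: "length (vertex_list H) = card (pverts H)"
    using vl distinct_card by metis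
  have "out_arcs (with_proj H) u = Pair u ` {w. (u, w) \<in> parcs H}" for u
    by (auto simp: out_arcs_def)
  then have od: "out_degree (with_proj H) u = card {w. (u, w) \<in> parcs H}" for u
    by (simp add: out_degree_def card_image inj_on_def)
  show ?thesis
    using pair_graphD(6)[OF H] vl(1)
    by (intro eq_matI)
      (auto simp: laplacian_def degree_matrix_def adjacency_matrix_def laplacian_wrt_def
        laplacian_entry_def len od nth_eq_iff_index_eq)
qed

lemma char_poly_laplacian:
  assumes H: "pair_graph H" and xs: "distinct xs" "set xs = pverts H"
  shows "char_poly (laplacian H) = char_poly (laplacian_wrt H xs)"
  unfolding laplacian_eq_laplacian_wrt[OF H] unfolding laplacian_wrt_def
  by (rule char_poly_reorder) (use xs vertex_list[OF pair_graphD(1)[OF H]] in auto)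

section \<open>Counting arcs and recognizing complete graphs\<close>

lemma sum_nth_distinct:
  assumes "distinct xs"
  shows "(\<Sum>i<length xs. f (xs ! i)) = (\<Sum>u\<in>set xs. f u)"
  by (rule sum.reindex_bij_betw) (use bij_betw_nth[OF assms refl refl] in simp)

lemma card_parcs_eq_sum:
  assumes H: "pair_graph H"
  shows "card (parcs H) = (\<Sum>u\<in>pverts H. card {v. (u, v) \<in> parcs H})"
proof -
  have "parcs H = Sigma (pverts H) (\<lambda>u. {v. (u, v) \<in> parcs H})"
    using pair_graphD(3)[OF H] by auto
  moreover have "finite {v. (u, v) \<in> parcs H}" for u
    by (rule finite_subset[OF _ pair_graphD(1)[OF H]]) (use pair_graphD(4)[OF H] in auto)
  ultimately show ?thesis
    using pair_graphD(1)[OF H] card_SigmaI[of "pverts H" "\<lambda>u. {v. (u, v) \<in> parcs H}"] by simp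
qed

text \<open>The arcs are partitioned by their underlying edges; symmetry and the absence of loops
  make each fibre a pair of opposite, distinct arcs.\<close>

lemma card_parcs:
  assumes H: "pair_graph H"
  shows "card (parcs H) = 2 * num_edges H"
proof -
  let ?F = "\<lambda>e. {a \<in> parcs H. {fst a, snd a} = e}"
  have U: "parcs H = (\<Union>e\<in>edges H. ?F e)"
    by (force simp: edges_def)
  have E: "edges H = (\<lambda>a. {fst a, snd a}) ` parcs H"
    by (force simp: edges_def)
  have 2: "card (?F e) = 2" if e: "e \<in> edges H" for e
  proof -
    obtain u v where uv: "(u, v) \<in> parcs H" "e = {u, v}" using e by (auto simp: edges_def)
    then have "?F e = {(u, v), (v, u)}"
      using pair_graphD(5)[OF H] by (auto simp: doubleton_eq_iff)
    moreover have "u \<noteq> v" using uv pair_graphD(6)[OF H] by auto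
    ultimately show ?thesis by simp
  qed
  have "card (parcs H) = (\<Sum>e\<in>edges H. card (?F e))"
    by (subst U, rule card_UN_disjoint) (use pair_graphD(2)[OF H] E in auto)
  then show ?thesis using 2 by (simp add: num_edges_def)
qed

lemma card_off_diagonal:
  assumes "finite V"
  shows "card {(u, v). u \<in> V \<and> v \<in> V \<and> u \<noteq> v} = card V * card V - card V"
proof -
  have "{(u, v). u \<in> V \<and> v \<in> V \<and> u \<noteq> v} = V \<times> V - (\<lambda>u. (u, u)) ` V" by auto
  also have "card \<dots> = card (V \<times> V) - card ((\<lambda>u. (u, u)) ` V)"
    by (rule card_Diff_subset) (use assms in auto)
  finally show ?thesis by (simp add: card_cartesian_product card_image inj_on_def)
qed

text \<open>The three properties are proved equivalent in a cycle: an isomorphism preserves the arc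
  count, a maximal count leaves no pair out, and full adjacency makes every vertex bijection an
  isomorphism. The count serves the equality case, the arc set the structure of the join.\<close>

lemma graph_isomorphic_complete_iff:
  assumes G: "pair_graph G" and p: "card (pverts G) = p"
  shows "graph_isomorphic G (complete_graph p) \<longleftrightarrow> card (parcs G) = p * p - p"
    and "graph_isomorphic G (complete_graph p)
      \<longleftrightarrow> parcs G = {(u, v). u \<in> pverts G \<and> v \<in> pverts G \<and> u \<noteq> v}"
proof -
  let ?O = "\<lambda>V. {(u, v). u \<in> V \<and> v \<in> V \<and> u \<noteq> v}"
  note fin = pair_graphD(1)[OF G]
  have sub: "parcs G \<subseteq> ?O (pverts G)" using pair_graphD(3,4,6)[OF G] by auto
  have finO: "finite (?O (pverts G))"
    by (rule finite_subset[of _ "pverts G \<times> pverts G"]) (use fin in auto)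
  have K: "parcs (complete_graph p) = ?O {..<p}" by (auto simp: complete_graph_def)
  have iso_card: "card (parcs G) = p * p - p" if iso: "graph_isomorphic G (complete_graph p)"
  proof -
    obtain f where f: "pre_digraph.digraph_isomorphism (with_proj G) f"
        "with_proj (complete_graph p) = app_iso f (with_proj G)"
      using iso by (auto simp: graph_isomorphic_def digraph_iso_def)
    have "parcs (complete_graph p) = iso_arcs f ` parcs G"
      using arg_cong[OF f(2), of arcs] by (simp add: arcs_app_iso)
    moreover have "inj_on (iso_arcs f) (parcs G)"
      using pre_digraph.digraph_isomorphism_inj_on_arcs[OF f(1)] by simp
    ultimately have "card (parcs G) = card (?O {..<p})" using K card_image by metis
    then show ?thesis by (simp only: card_off_diagonal finite_lessThan card_lessThan)
  qed
  have card_full: "parcs G = ?O (pverts G)" if "card (parcs G) = p * p - p"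
    by (rule card_subset_eq[OF finO sub]) (simp only: card_off_diagonal[OF fin] p that)
  have full_iso: "graph_isomorphic G (complete_graph p)" if full: "parcs G = ?O (pverts G)"
  proof -
    obtain h where h: "bij_betw h (pverts G) {..<p}"
      using finite_same_card_bij[OF fin, of "{..<p}"] p by auto
    \<comment> \<open>Any vertex bijection \<open>h\<close> works once it is applied to both ends of
      each arc.\<close>
    define f where "f = \<lparr>iso_verts = h, iso_arcs = map_prod h h, iso_head = snd, iso_tail = fst\<rparr>"
    interpret pair_graph G by fact
    have inj: "inj_on h (pverts G)" and im: "h ` pverts G = {..<p}"
      using h by (auto simp: bij_betw_def)
    have arcs_im: "map_prod h h ` parcs G = ?O {..<p}"
    proof -
      have "map_prod h h ` ?O (pverts G) = ?O (h ` pverts G)"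
        using inj by (force simp: inj_on_def)
      then show ?thesis using full im by simp
    qed
    have "inj_on (map_prod h h) (parcs G)"
      by (rule inj_on_subset[OF map_prod_inj_on[OF inj inj]]) (use sub in auto)
    then have "digraph_isomorphism f"
      unfolding digraph_isomorphism_def f_def using inj wf_digraph_axioms by auto
    moreover have "with_proj (complete_graph p) = app_iso f (with_proj G)"
      using im arcs_im K by (simp add: app_iso_def with_proj_def f_def complete_graph_def)
    ultimately show ?thesis by (auto simp: graph_isomorphic_def digraph_iso_def)
  qed
  show "graph_isomorphic G (complete_graph p) \<longleftrightarrow> card (parcs G) = p * p - p"
    using iso_card card_full full_iso by blast
  show "graph_isomorphic G (complete_graph p) \<longleftrightarrow> parcs G = ?O (pverts G)"
    using iso_card card_full full_iso by blast
qed

lemma card_parcs_le: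
  assumes G: "pair_graph G"
  shows "card (parcs G) \<le> card (pverts G) * card (pverts G) - card (pverts G)"
proof -
  let ?O = "{(u, v). u \<in> pverts G \<and> v \<in> pverts G \<and> u \<noteq> v}"
  have "parcs G \<subseteq> ?O" using pair_graphD(3,4,6)[OF G] by auto
  moreover have "finite ?O"
    by (rule finite_subset[of _ "pverts G \<times> pverts G"]) (use pair_graphD(1)[OF G] in auto)
  ultimately have "card (parcs G) \<le> card ?O" by (intro card_mono)
  then show ?thesis by (simp only: card_off_diagonal[OF pair_graphD(1)[OF G]])
qed

section \<open>The Laplacian quadratic form and bounds on eigenvalues\<close>

lemma laplacian_apply:
  assumes H: "pair_graph H" and u: "u \<in> pverts H"
  shows "(\<Sum>v\<in>pverts H. laplacian_entry H u v * x v) = (\<Sum>v | (u, v) \<in> parcs H. x u - x v)"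
proof -
  let ?N = "{v. (u, v) \<in> parcs H}"
  have N: "?N \<subseteq> pverts H" "u \<notin> ?N" using pair_graphD(4,6)[OF H] by auto
  note fin = pair_graphD(1)[OF H]
  have "(\<Sum>v\<in>pverts H. laplacian_entry H u v * x v)
      = (\<Sum>v\<in>pverts H. (if u = v then real (card ?N) * x v else 0) - (if v \<in> ?N then x v else 0))"
    using N(2) by (intro sum.cong) (auto simp: laplacian_entry_def)
  also have "\<dots> = real (card ?N) * x u - (\<Sum>v\<in>?N. x v)"
    using fin u N(1) by (simp add: sum_subtractf sum.If_cases Int_absorb1)
  finally show ?thesis by (simp add: sum_subtractf)
qed

text \<open>Twice the form is the sum of \<open>(x u - x v)\<^sup>2\<close> over all arcs, hence
  nonnegative. Enlarging the sum to all ordered pairs compares with the complete graph and gives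
  \<open>2 * p\<close> times the sum of squares minus twice the square of the sum.\<close>

lemma laplacian_quadratic_form:
  assumes H: "pair_graph H" and p: "card (pverts H) = p"
  defines "Q \<equiv> \<lambda>x :: 'a \<Rightarrow> real. \<Sum>u\<in>pverts H. x u * (\<Sum>v | (u, v) \<in> parcs H. x u - x v)"
  shows "0 \<le> Q x" and "Q x \<le> real p * (\<Sum>u\<in>pverts H. (x u)\<^sup>2)"
proof -
  let ?V = "pverts H"
  note fin = pair_graphD(1,2)[OF H]
  have finN: "finite {v. (u, v) \<in> parcs H}" for u
    by (rule finite_subset[OF _ fin(1)]) (use pair_graphD(4)[OF H] in auto)
  have Sig: "parcs H = Sigma ?V (\<lambda>u. {v. (u, v) \<in> parcs H})"
    using pair_graphD(3)[OF H] by auto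
  have Q1: "Q x = (\<Sum>(u, v)\<in>parcs H. x u * (x u - x v))"
    using sum.Sigma[of ?V "\<lambda>u. {v. (u, v) \<in> parcs H}" "\<lambda>u v. x u * (x u - x v)"] fin finN
    by (simp add: Q_def sum_distrib_left flip: Sig)
  \<comment> \<open>Reversing arcs exchanges the roles of \<open>u\<close> and \<open>v\<close>;
    adding the two expressions for \<open>Q x\<close> symmetrizes it into squares.\<close>
  have "bij_betw prod.swap (parcs H) (parcs H)"
    by (rule bij_betwI[where g = prod.swap]) (use pair_graphD(5)[OF H] in auto)
  from sum.reindex_bij_betw[OF this, of "\<lambda>(u, v). x u * (x u - x v)"]
  have Q2: "Q x = (\<Sum>(u, v)\<in>parcs H. x v * (x v - x u))"
    by (simp add: Q1 case_prod_unfold)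
  have "Q x + Q x = (\<Sum>(u, v)\<in>parcs H. x u * (x u - x v) + x v * (x v - x u))"
    by (subst (2) Q2, subst Q1) (simp add: sum.distrib case_prod_unfold)
  also have "\<dots> = (\<Sum>(u, v)\<in>parcs H. (x u - x v)\<^sup>2)"
    by (intro sum.cong) (auto simp: power2_eq_square algebra_simps)
  finally have QQ: "Q x + Q x = (\<Sum>(u, v)\<in>parcs H. (x u - x v)\<^sup>2)" .
  moreover have "0 \<le> (\<Sum>(u, v)\<in>parcs H. (x u - x v)\<^sup>2)"
    by (rule sum_nonneg) auto
  ultimately show "0 \<le> Q x" by linarith
  have "(\<Sum>(u, v)\<in>parcs H. (x u - x v)\<^sup>2) \<le> (\<Sum>(u, v)\<in>?V \<times> ?V. (x u - x v)\<^sup>2)"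
    by (rule sum_mono2) (use fin pair_graphD(3,4)[OF H] in auto)
  also have "\<dots> = (\<Sum>u\<in>?V. \<Sum>v\<in>?V. (x u)\<^sup>2 + (x v)\<^sup>2 - 2 * (x u * x v))"
    unfolding sum.cartesian_product[symmetric]
    by (intro sum.cong) (auto simp: power2_eq_square algebra_simps)
  also have "\<dots> = real p * (\<Sum>u\<in>?V. (x u)\<^sup>2) + real p * (\<Sum>u\<in>?V. (x u)\<^sup>2)
      - 2 * ((\<Sum>u\<in>?V. x u) * (\<Sum>u\<in>?V. x u))"
    by (simp add: sum.distrib sum_subtractf p flip: sum_distrib_left sum_distrib_right)
  finally show "Q x \<le> real p * (\<Sum>u\<in>pverts H. (x u)\<^sup>2)"
    using QQ zero_le_square[of "\<Sum>u\<in>?V. x u"] by linarith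
qed

lemma laplacian_wrt_mult_vec:
  assumes H: "pair_graph H" and xs: "distinct xs" "set xs = pverts H" and i: "i < length xs"
  shows "(laplacian_wrt H xs *\<^sub>v vec (length xs) (\<lambda>j. x (xs ! j))) $ i
    = (\<Sum>v | (xs ! i, v) \<in> parcs H. x (xs ! i) - x v)"
proof -
  have "(laplacian_wrt H xs *\<^sub>v vec (length xs) (\<lambda>j. x (xs ! j))) $ i
      = (\<Sum>j<length xs. laplacian_entry H (xs ! i) (xs ! j) * x (xs ! j))"
    using i by (auto simp: laplacian_wrt_def scalar_prod_def atLeast0LessThan intro!: sum.cong)
  also have "\<dots> = (\<Sum>v\<in>pverts H. laplacian_entry H (xs ! i) v * x v)"
    unfolding sum_nth_distinct[OF xs(1), of "\<lambda>v. laplacian_entry H (xs ! i) v * x v"] xs(2) ..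
  finally show ?thesis using laplacian_apply[OF H] i xs(2) nth_mem by metis
qed

text \<open>At an eigenvector the quadratic form is \<open>a\<close> times the positive sum of
  squares, so the bounds on the form become bounds on \<open>a\<close>.\<close>

lemma laplacian_eigenvalue_bounds:
  assumes H: "pair_graph H" and xs: "distinct xs" "set xs = pverts H"
    and ev: "eigenvalue (laplacian_wrt H xs) a"
  shows "0 \<le> a" and "a \<le> real (length xs)"
proof -
  let ?n = "length xs" and ?V = "pverts H"
  obtain v where v: "v \<in> carrier_vec ?n" "v \<noteq> 0\<^sub>v ?n" "laplacian_wrt H xs *\<^sub>v v = a \<cdot>\<^sub>v v"
    using ev by (auto simp: eigenvalue_def eigenvector_def laplacian_wrt_def)
  \<comment> \<open>\<open>x\<close> reads the position-indexed vector \<open>v\<close> as a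
    function on vertices.\<close>
  define x where "x u = v $ (inv_into {..<?n} (nth xs) u)" for u
  have "inj_on (nth xs) {..<?n}" using xs(1) by (auto simp: inj_on_def nth_eq_iff_index_eq)
  then have x: "x (xs ! i) = v $ i" if "i < ?n" for i
    using that by (simp add: x_def inv_into_f_f)
  have vx: "v = vec ?n (\<lambda>j. x (xs ! j))" using v(1) x by (intro eq_vecI) auto
  have ax: "(\<Sum>w | (u, w) \<in> parcs H. x u - x w) = a * x u" if u: "u \<in> ?V" for u
  proof -
    obtain i where i: "i < ?n" "u = xs ! i" using u xs(2) by (metis in_set_conv_nth)
    have "(laplacian_wrt H xs *\<^sub>v v) $ i = a * x u" using v(1,3) i x by simp
    then show ?thesis using laplacian_wrt_mult_vec[OF H xs i(1), of x] vx i(2) by simp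
  qed
  let ?S = "\<Sum>u\<in>?V. (x u)\<^sup>2"
  have "(\<Sum>u\<in>?V. x u * (\<Sum>w | (u, w) \<in> parcs H. x u - x w)) = a * ?S"
    by (simp add: ax sum_distrib_left power2_eq_square mult_ac)
  then have b: "0 \<le> a * ?S" "a * ?S \<le> real ?n * ?S"
    using laplacian_quadratic_form[OF H refl, of x] distinct_card[OF xs(1)] xs(2) by auto
  have "?S \<noteq> 0"
  proof
    assume "?S = 0"
    then have "\<forall>u\<in>?V. x u = 0"
      using pair_graphD(1)[OF H] by (simp add: sum_nonneg_eq_0_iff)
    then have "x (xs ! i) = 0" if "i < ?n" for i using nth_mem[OF that] xs(2) by simp
    then have "v = 0\<^sub>v ?n" using v(1) x by (intro eq_vecI) auto
    with v(2) show False by simp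
  qed
  then have "0 < ?S" by (simp add: order.strict_iff_order sum_nonneg)
  then show "0 \<le> a" "a \<le> real ?n" using b by (simp_all add: zero_le_mult_iff)
qed

text \<open>The trace is the degree sum, which is the number of arcs and so twice the number of
  edges. The eigenvalue 0 comes from the constant vector, which is nonzero only when there is a
  vertex. The list \<open>es\<close> records multiplicities but no order.\<close>

lemma laplacian_spectrum:
  assumes H: "pair_graph H"
  obtains es where "char_poly (laplacian H) = (\<Prod>a\<leftarrow>es. [:- a, 1:])"
    "length es = card (pverts H)" "\<And>a. a \<in> set es \<Longrightarrow> 0 \<le> a \<and> a \<le> real (card (pverts H))"
    "sum_list es = 2 * real (num_edges H)" "pverts H \<noteq> {} \<Longrightarrow> 0 \<in> set es"
proof -
  define xs where "xs = vertex_list H"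
  have xs: "distinct xs" "set xs = pverts H"
    using vertex_list[OF pair_graphD(1)[OF H]] by (auto simp: xs_def)
  let ?n = "length xs" and ?L = "laplacian_wrt H xs"
  have n: "?n = card (pverts H)" using distinct_card[OF xs(1)] xs(2) by simp
  have L: "laplacian H = ?L" unfolding xs_def by (rule laplacian_eq_laplacian_wrt[OF H])
  have "?L $$ (i, j) = ?L $$ (j, i)" if "i < ?n" "j < ?n" for i j
    using that pair_graphD(5)[OF H] by (auto simp: laplacian_wrt_def laplacian_entry_def)
  then obtain es where es: "char_poly ?L = (\<Prod>a\<leftarrow>es. [:- a, 1:])" "length es = ?n"
    using symmetric_real_char_poly_splits[OF laplacian_wrt_carrier] by blast
  have ev: "eigenvalue ?L a \<longleftrightarrow> a \<in> set es" for a
    unfolding eigenvalue_root_char_poly[OF laplacian_wrt_carrier] es(1)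
    by (auto simp: poly_prod_list prod_list_zero_iff)
  have "sum_list es = (\<Sum>i<?n. real (card {w. (xs ! i, w) \<in> parcs H}))"
    unfolding sum_list_eigenvalues[OF laplacian_wrt_carrier es(1)]
    by (simp add: laplacian_wrt_def laplacian_entry_def)
  also have "\<dots> = real (card (parcs H))"
    unfolding sum_nth_distinct[OF xs(1), of "\<lambda>u. real (card {w. (u, w) \<in> parcs H})"]
    by (simp add: xs(2) card_parcs_eq_sum[OF H])
  finally have sum: "sum_list es = 2 * real (num_edges H)" by (simp add: card_parcs[OF H])
  have "0 \<in> set es" if "pverts H \<noteq> {}"
  proof -
    let ?v = "vec ?n (\<lambda>j. 1 :: real)"
    have "?L *\<^sub>v ?v = 0 \<cdot>\<^sub>v ?v"
      using laplacian_wrt_mult_vec[OF H xs, of _ "\<lambda>_. 1"]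
      by (intro eq_vecI) (auto simp: laplacian_wrt_def)
    moreover have "?v \<noteq> 0\<^sub>v ?n"
    proof
      assume "?v = 0\<^sub>v ?n"
      then have "?v $ 0 = 0\<^sub>v ?n $ 0" by simp
      moreover have "0 < ?n" using that xs(2) by auto
      ultimately show False by simp
    qed
    ultimately have "eigenvector ?L ?v 0"
      by (simp add: eigenvector_def laplacian_wrt_def)
    then have "eigenvalue ?L 0" unfolding eigenvalue_def by blast
    then show ?thesis by (simp add: ev)
  qed
  then show ?thesis
    using that[of es] es sum ev laplacian_eigenvalue_bounds[OF H xs] n L by simp
qed

text \<open>A product of monic linear factors has its parameters as root multiset, and a multiset
  has only one sorted listing. So exhibiting a nonincreasing list of roots determines the
  spectrum.\<close>

lemma laplacian_eigenvalues_eqI: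
  assumes "char_poly (laplacian H) = (\<Prod>a\<leftarrow>es. [:- a, 1:])" and "sorted (rev es)"
  shows "laplacian_eigenvalues H = es"
proof -
  have "proots (\<Prod>a\<leftarrow>es. [:- a, 1:]) = mset es" for es :: "real list"
  proof (induction es)
    case (Cons a es)
    have "(\<Prod>a\<leftarrow>es. [:- a, 1:]) \<noteq> 0" by (auto simp: prod_list_zero_iff)
    then show ?case using Cons by (simp add: proots_mult del: mult_pCons_left)
  qed simp
  then have "proots (char_poly (laplacian H)) = mset (rev es)" using assms(1) by simp
  then show ?thesis using assms(2)
    by (simp add: laplacian_eigenvalues_def sorted_sort_id del: mset_rev)
qed

text \<open>The reindexing reconciles eigenvalues counted from 1 with list positions from 0; the
  bound on \<open>k\<close> keeps all accesses in range.\<close>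

lemma laplacian_sum_eq:
  assumes "k \<le> length (laplacian_eigenvalues H)"
  shows "laplacian_sum k H = sum_list (take k (laplacian_eigenvalues H))"
proof -
  have "laplacian_sum k H = (\<Sum>i<k. laplacian_eigenvalues H ! i)"
    unfolding laplacian_sum_def laplacian_eigenvalue_def
    by (rule sum.reindex_bij_witness[of _ Suc "\<lambda>i. i - 1"]) auto
  then show ?thesis using assms by (simp add: sum_list_sum_nth atLeast0LessThan)
qed

section \<open>Joins with an independent set\<close>

lemma pair_graph_edgeless: "pair_graph (edgeless_graph q)"
  by unfold_locales (auto simp: edgeless_graph_def symmetric_def sym_def arcs_ends_def)

lemma pair_graph_join:
  assumes G: "pair_graph G" and H: "pair_graph H"
  shows "pair_graph (graph_join G H)"
proof -
  note g = pair_graphD[OF G] and h = pair_graphD[OF H]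
  let ?V = "pverts G <+> pverts H"
  have V: "finite ?V" using g(1) h(1) by simp
  have sub: "parcs (graph_join G H) \<subseteq> ?V \<times> ?V"
    using g(3,4) h(3,4) by (auto simp: graph_join_def)
  have sym: "sym (parcs (graph_join G H))"
    using g(5) h(5) by (auto simp: graph_join_def sym_def)
  have irr: "fst e \<noteq> snd e" if "e \<in> parcs (graph_join G H)" for e
    using that g(6) h(6) by (auto simp: graph_join_def)
  show ?thesis
  proof unfold_locales
    fix e assume "e \<in> parcs (graph_join G H)"
    then have e: "e \<in> ?V \<times> ?V" and ne: "fst e \<noteq> snd e" using sub irr by auto
    show "fst e \<in> pverts (graph_join G H)" "snd e \<in> pverts (graph_join G H)"
      using e by (auto simp: graph_join_def)
    show "fst e \<noteq> snd e" by (fact ne)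
  next
    show "finite (pverts (graph_join G H))" using V by (simp add: graph_join_def)
    show "finite (parcs (graph_join G H))" using finite_subset[OF sub] V by simp
    show "symmetric (with_proj (graph_join G H))" using sym by (simp add: symmetric_def)
  qed
qed

text \<open>Arcs are counted instead of edges, because they split into four disjoint injective
  images; halving gives the claim.\<close>

lemma num_edges_join:
  fixes G :: "'a pair_pre_digraph" and H :: "'b pair_pre_digraph"
  assumes G: "pair_graph G" and H: "pair_graph H"
  shows "num_edges (graph_join G H)
    = num_edges G + num_edges H + card (pverts G) * card (pverts H)"
proof -
  note g = pair_graphD[OF G] and h = pair_graphD[OF H]
  let ?X = "pverts G \<times> pverts H"
  let ?A = "map_prod Inl Inl ` parcs G :: ('a + 'b) rel"
    and ?B = "map_prod Inr Inr ` parcs H :: ('a + 'b) rel"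
    and ?C = "map_prod Inl Inr ` ?X :: ('a + 'b) rel"
    and ?D = "(\<lambda>(u, v). (Inr v, Inl u)) ` ?X :: ('a + 'b) rel"
  have "parcs (graph_join G H) = ?A \<union> (?B \<union> (?C \<union> ?D))"
    by (force simp: graph_join_def)
  also have "card \<dots> = card ?A + (card ?B + (card ?C + card ?D))"
  proof -
    have "finite ?A" "finite ?B" "finite ?C" "finite ?D" using g(1,2) h(1,2) by auto
    moreover have "?A \<inter> (?B \<union> (?C \<union> ?D)) = {}" "?B \<inter> (?C \<union> ?D) = {}" "?C \<inter> ?D = {}" by auto
    ultimately show ?thesis by (simp only: card_Un_disjoint finite_Un simp_thms)
  qed
  also have "card ?A = card (parcs G)" by (intro card_image inj_onI) auto
  also have "card ?B = card (parcs H)" by (intro card_image inj_onI) auto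
  also have "card ?C = card ?X" by (intro card_image inj_onI) auto
  also have "card ?D = card ?X" by (intro card_image inj_onI) auto
  finally show ?thesis
    using card_parcs[OF G] card_parcs[OF H] card_parcs[OF pair_graph_join[OF G H]]
    by (simp add: card_cartesian_product)
qed

section \<open>The characteristic polynomial of the join\<close>

lemma laplacian_entry_join_edgeless:
  fixes q :: nat
  assumes G: "pair_graph G"
  defines "J \<equiv> graph_join G (edgeless_graph q)"
  shows "u \<in> pverts G \<Longrightarrow>
      laplacian_entry J (Inl u) (Inl v) = laplacian_entry G u v + (if u = v then real q else 0)"
    and "u \<in> pverts G \<Longrightarrow> i < q \<Longrightarrow> laplacian_entry J (Inl u) (Inr i) = - 1"
    and "u \<in> pverts G \<Longrightarrow> i < q \<Longrightarrow> laplacian_entry J (Inr i) (Inl u) = - 1"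
    and "i < q \<Longrightarrow>
      laplacian_entry J (Inr i) (Inr j) = (if i = j then real (card (pverts G)) else 0)"
proof -
  note g = pair_graphD[OF G]
  have arcs: "(Inl u, Inl v) \<in> parcs J \<longleftrightarrow> (u, v) \<in> parcs G" "(Inr i, Inr j) \<notin> parcs J" for u v i j
    by (auto simp: J_def graph_join_def edgeless_graph_def)
  have "card {w. (Inl u, w) \<in> parcs J} = card {w. (u, w) \<in> parcs G} + q" if "u \<in> pverts G" for u
  proof -
    have "{w. (Inl u, w) \<in> parcs J} = {w. (u, w) \<in> parcs G} <+> {..<q}"
      using that by (auto simp: J_def graph_join_def edgeless_graph_def)
    moreover have "finite {w. (u, w) \<in> parcs G}"
      by (rule finite_subset[OF _ g(1)]) (use g(4) in auto)
    ultimately show ?thesis by (simp add: card_Plus)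
  qed
  then show "u \<in> pverts G \<Longrightarrow>
      laplacian_entry J (Inl u) (Inl v) = laplacian_entry G u v + (if u = v then real q else 0)"
    by (auto simp: laplacian_entry_def arcs)
  have "{w. (Inr i, w) \<in> parcs J} = Inl ` pverts G" if "i < q" for i
    using that by (auto simp: J_def graph_join_def edgeless_graph_def)
  then show "i < q \<Longrightarrow>
      laplacian_entry J (Inr i) (Inr j) = (if i = j then real (card (pverts G)) else 0)"
    by (simp add: laplacian_entry_def arcs card_image)
qed (simp_all add: laplacian_entry_def J_def graph_join_def edgeless_graph_def)

text \<open>With the vertices of \<open>G\<close> listed first, \<open>x\<close> times the identity
  minus the Laplacian has the block form of \<open>det_join_block\<close>, up to
  \<open>z = x - q\<close> and \<open>w = x - p\<close>, whose vanishing is excluded. The last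
  factor arises from \<open>(x - q) * (x - p) - p * q\<close>.\<close>

lemma poly_char_poly_join_edgeless:
  fixes x :: real
  assumes G: "pair_graph G" and p: "card (pverts G) = p" and x: "x \<noteq> real q" "x \<noteq> real p"
  shows "poly (char_poly (laplacian (graph_join G (edgeless_graph q)))) x
      * ((x - real q) * (x - real p))
    = poly (char_poly (laplacian G)) (x - real q) * (x - real p) ^ q * (x * (x - (real p + real q)))"
proof -
  let ?J = "graph_join G (edgeless_graph q)"
  define xs where "xs = vertex_list G"
  have xs: "distinct xs" "set xs = pverts G"
    using vertex_list[OF pair_graphD(1)[OF G]] by (auto simp: xs_def)
  have len: "length xs = p" using distinct_card[OF xs(1)] xs(2) p by simp
  have V: "xs ! i \<in> pverts G" if "i < p" for i using that nth_mem xs(2) len by auto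
  define ys where "ys = map Inl xs @ map Inr [0..<q]"
  have ys: "distinct ys" "set ys = pverts ?J"
    using xs by (auto simp: ys_def distinct_map graph_join_def edgeless_graph_def)
  have leny: "length ys = p + q" by (simp add: ys_def len)
  let ?L = "laplacian_wrt G xs" and ?K = "laplacian_wrt ?J ys"
  have L: "?L \<in> carrier_mat p p" and K: "?K \<in> carrier_mat (p + q) (p + q)"
    using laplacian_wrt_carrier[of G xs] laplacian_wrt_carrier[of ?J ys] len leny by auto
  define M where "M = - char_matrix ?L (x - real q)"
  have M: "M \<in> carrier_mat p p" using L by (simp add: M_def char_matrix_def)
  have Mij: "M $$ (i, j) = (if i = j then x - real q else 0) - laplacian_entry G (xs ! i) (xs ! j)"
    if "i < p" "j < p" for i j
    using that len by (simp add: M_def char_matrix_def laplacian_wrt_def)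
  have blk: "- char_matrix ?K x =
      four_block_mat M (mat p q (\<lambda>_. 1)) (mat q p (\<lambda>_. 1)) ((x - real p) \<cdot>\<^sub>m 1\<^sub>m q)" (is "_ = ?F")
  proof (rule eq_matI)
    fix i j assume "i < dim_row ?F" "j < dim_col ?F"
    then have ij: "i < p + q" "j < p + q" using M by auto
    have "(- char_matrix ?K x) $$ (i, j)
        = (if i = j then x else 0) - laplacian_entry ?J (ys ! i) (ys ! j)"
      using ij leny by (simp add: char_matrix_def laplacian_wrt_def)
    then show "(- char_matrix ?K x) $$ (i, j) = ?F $$ (i, j)"
      using ij M xs(1) len
      by (cases "i < p"; cases "j < p")
        (auto simp: ys_def nth_append Mij V p laplacian_entry_join_edgeless[OF G]
          nth_eq_iff_index_eq)
  qed (use M K in \<open>auto simp: char_matrix_def\<close>)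
  \<comment> \<open>The rows of the Laplacian of \<open>G\<close> sum to 0, as seen by applying it
    to the constant function.\<close>
  have rows: "(\<Sum>j<p. M $$ (i, j)) = x - real q" if i: "i < p" for i
  proof -
    have "(\<Sum>j<p. laplacian_entry G (xs ! i) (xs ! j)) = (\<Sum>v\<in>pverts G. laplacian_entry G (xs ! i) v)"
      using sum_nth_distinct[OF xs(1), of "laplacian_entry G (xs ! i)"] len xs(2) by simp
    also have "\<dots> = 0" using laplacian_apply[OF G V[OF i], of "\<lambda>_. 1"] by simp
    finally show ?thesis using i by (simp add: Mij sum_subtractf)
  qed
  have "poly (char_poly (laplacian ?J)) x = det (- char_matrix ?K x)"
    using char_poly_laplacian[OF pair_graph_join[OF G pair_graph_edgeless] ys] char_poly_matrix[OF K]
    by simp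
  moreover have "poly (char_poly (laplacian G)) (x - real q) = det M"
    unfolding M_def using char_poly_laplacian[OF G xs] char_poly_matrix[OF L] by simp
  ultimately have "poly (char_poly (laplacian ?J)) x * ((x - real q) * (x - real p))
      = poly (char_poly (laplacian G)) (x - real q) * (x - real p) ^ q
        * ((x - real q) * (x - real p) - real p * real q)"
    using det_join_block[OF M rows, of "x - real p" q] x by (simp add: blk)
  also have "(x - real q) * (x - real p) - real p * real q = x * (x - (real p + real q))"
    by (simp add: algebra_simps)
  finally show ?thesis .
qed

text \<open>A nonzero difference has finitely many roots, but a domain of characteristic 0 is
  infinite. This removes the excluded values \<open>p\<close> and \<open>q\<close>.\<close>

lemma poly_eqI_cofinite:
  fixes f g :: "'a :: {idom, ring_char_0} poly"
  assumes "finite S" and "\<And>x. x \<notin> S \<Longrightarrow> poly f x = poly g x"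
  shows "f = g"
proof (rule ccontr)
  assume "f \<noteq> g"
  then have "finite {x. poly (f - g) x = 0}" by (intro poly_roots_finite) simp
  moreover have "UNIV \<subseteq> S \<union> {x. poly (f - g) x = 0}" using assms(2) by auto
  ultimately have "finite (UNIV :: 'a set)" using assms(1) by (meson finite_UnI finite_subset)
  then show False using infinite_UNIV_char_0 by blast
qed

lemma poly_linear_factors:
  fixes x :: "'a :: comm_ring_1"
  shows "poly (\<Prod>a\<leftarrow>es. [:- a, 1:]) x = (\<Prod>a\<leftarrow>es. x - a)"
  by (induction es) (simp_all add: uminus_add_conv_diff del: mult_pCons_left)

text \<open>\<open>fs\<close> is the spectrum of \<open>G\<close> with one 0 removed. That 0
  contributes a factor \<open>x - q\<close>, which cancels together with one of the \<open>q\<close>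
  factors \<open>x - p\<close>; the new factors are \<open>x\<close> and
  \<open>x - (p + q)\<close>.\<close>

lemma char_poly_join_edgeless:
  assumes G: "pair_graph G" and p: "card (pverts G) = p" and pos: "0 < p" "0 < q"
    and es: "char_poly (laplacian G) = (\<Prod>a\<leftarrow>es. [:- a, 1:])" "mset es = add_mset 0 (mset fs)"
  shows "char_poly (laplacian (graph_join G (edgeless_graph q)))
    = (\<Prod>a\<leftarrow>(real p + real q) # map ((+) (real q)) fs @ replicate (q - 1) (real p) @ [0]. [:- a, 1:])"
    (is "?c = ?r")
proof (rule poly_eqI_cofinite)
  show "finite {real p, real q}" by simp
  fix x :: real assume "x \<notin> {real p, real q}"
  then have x: "x \<noteq> real q" "x \<noteq> real p" by auto
  have "(\<Prod>a\<leftarrow>es. (x - real q) - a) = prod_mset (image_mset (\<lambda>a. (x - real q) - a) (mset es))"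
    by (simp add: prod_mset_prod_list flip: mset_map)
  also have "\<dots> = (x - real q) * (\<Prod>a\<leftarrow>fs. (x - real q) - a)"
    by (simp add: es(2) prod_mset_prod_list flip: mset_map)
  finally have "poly ?c x * ((x - real q) * (x - real p))
      = (x - real q) * (\<Prod>a\<leftarrow>fs. (x - real q) - a) * (x - real p) ^ q * (x * (x - (real p + real q)))"
    using poly_char_poly_join_edgeless[OF G p x] by (simp add: es(1) poly_linear_factors)
  also have "(x - real p) ^ q = (x - real p) ^ (q - 1) * (x - real p)"
    by (rule power_minus_mult[symmetric, OF pos(2)])
  finally have "poly ?c x * ((x - real q) * (x - real p))
      = ((\<Prod>a\<leftarrow>fs. (x - real q) - a) * (x - real p) ^ (q - 1) * (x * (x - (real p + real q))))
        * ((x - real q) * (x - real p))"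
    by (simp only: mult_ac)
  then have "poly ?c x
      = (\<Prod>a\<leftarrow>fs. (x - real q) - a) * (x - real p) ^ (q - 1) * (x * (x - (real p + real q)))"
    using x by simp
  also have "\<dots> = poly ?r x"
    by (simp only: poly_linear_factors)
      (simp add: o_def prod_list_replicate diff_diff_eq mult_ac)
  finally show "poly ?c x = poly ?r x" .
qed

text \<open>An empty \<open>G\<close> has no eigenvalue 0 to remove, so this case is separate: the
  join is just \<open>q\<close> isolated vertices.\<close>

lemma char_poly_join_edgeless_empty:
  assumes G: "pair_graph G" and p: "pverts G = {}"
  shows "char_poly (laplacian (graph_join G (edgeless_graph q)))
    = (\<Prod>a\<leftarrow>replicate q 0. [:- a, 1:])" (is "?c = ?r")
proof (rule poly_eqI_cofinite)
  show "finite {0, real q}" by simp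
  fix x :: real assume "x \<notin> {0, real q}"
  then have x: "x \<noteq> real q" "x \<noteq> 0" by auto
  obtain es where "char_poly (laplacian G) = (\<Prod>a\<leftarrow>es. [:- a, 1:])" "length es = 0"
    using laplacian_spectrum[OF G] p by (metis card.empty)
  then have "poly (char_poly (laplacian G)) y = 1" for y by simp
  then have "poly ?c x * ((x - real q) * x) = x ^ q * (x * (x - real q))"
    using poly_char_poly_join_edgeless[OF G, of 0 x q] p x by simp
  then show "poly ?c x = poly ?r x"
    using x by (simp add: poly_linear_factors prod_list_replicate)
qed

section \<open>Threshold structure and clique number in the extremal case\<close>

lemma threshold_graph_edgeless:
  assumes "0 < q"
  shows "threshold_graph \<lparr>pverts = f ` {..<q :: nat}, parcs = {}\<rparr>"
  using assms
proof (induction q)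
  case (Suc q)
  show ?case
  proof (cases "q = 0")
    case True
    then show ?thesis using threshold_graph.single by (simp add: lessThan_Suc)
  next
    case False
    then have IH: "threshold_graph \<lparr>pverts = f ` {..<q}, parcs = {}\<rparr>" using Suc by simp
    show ?thesis
    \<comment> \<open>A repeated value of \<open>f\<close> leaves the vertex set unchanged; a new
      value is added as an isolated vertex.\<close>
    proof (cases "f q \<in> f ` {..<q}")
      case True
      then show ?thesis using IH by (simp add: lessThan_Suc insert_absorb)
    next
      case False
      then show ?thesis using threshold_graph.isolated[OF IH, of "f q"] by (simp add: lessThan_Suc)
    qed
  qed
qed simp

text \<open>Start from the \<open>q\<close> independent vertices and add the elements of
  \<open>V\<close> one at a time as dominating vertices.\<close>

lemma threshold_graph_split:
  fixes V :: "'a set" and q :: nat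
  assumes "finite V" and q: "0 < q"
  shows "threshold_graph \<lparr>pverts = V <+> {..<q},
    parcs = {(a, b). a \<in> V <+> {..<q} \<and> b \<in> V <+> {..<q} \<and> a \<noteq> b
      \<and> \<not> (a \<in> range Inr \<and> b \<in> range Inr)}\<rparr>" (is "threshold_graph (?T V)")
  using assms(1)
proof (induction V)
  case empty
  have eq: "?T {} = \<lparr>pverts = Inr ` {..<q}, parcs = {}\<rparr>" by auto
  show ?case by (subst eq, rule threshold_graph_edgeless[OF q])
next
  case (insert v V)
  have eq: "?T (insert v V) = \<lparr>pverts = insert (Inl v) (pverts (?T V)),
      parcs = parcs (?T V) \<union> {Inl v} \<times> pverts (?T V) \<union> pverts (?T V) \<times> {Inl v}\<rparr>"
    using insert.hyps by auto
  show ?case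
    by (subst eq, rule threshold_graph.dominating[OF insert.IH]) (use insert.hyps in auto)
qed

text \<open>For full \<open>G\<close> the join is the graph of \<open>threshold_graph_split\<close>.
  A clique contains at most one independent vertex, and all of \<open>G\<close> with one such vertex
  attains the bound.\<close>

lemma join_complete_edgeless:
  assumes G: "pair_graph G" and p: "card (pverts G) = p" and q: "0 < q"
    and full: "parcs G = {(u, v). u \<in> pverts G \<and> v \<in> pverts G \<and> u \<noteq> v}"
  shows "threshold_graph (graph_join G (edgeless_graph q))"
    and "clique_number (graph_join G (edgeless_graph q)) = p + 1"
proof -
  let ?J = "graph_join G (edgeless_graph q)" and ?V = "pverts G"
  note fin = pair_graphD(1)[OF G]
  have "?J = \<lparr>pverts = ?V <+> {..<q}, parcs = {(a, b). a \<in> ?V <+> {..<q} \<and> b \<in> ?V <+> {..<q}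
      \<and> a \<noteq> b \<and> \<not> (a \<in> range Inr \<and> b \<in> range Inr)}\<rparr>"
    unfolding graph_join_def full edgeless_graph_def by auto
  then show "threshold_graph ?J" using threshold_graph_split[OF fin q] by simp
  have finJ: "finite (pverts ?J)" using fin by (simp add: graph_join_def edgeless_graph_def)
  show "clique_number ?J = p + 1"
    unfolding clique_number_def
  proof (rule Max_eqI)
    have "{card C |C. clique ?J C} \<subseteq> card ` Pow (pverts ?J)" by (auto simp: clique_def)
    then show "finite {card C |C. clique ?J C}" by (rule finite_subset) (use finJ in simp)
  next
    fix y assume "y \<in> {card C |C. clique ?J C}"
    then obtain C where C: "clique ?J C" and y: "y = card C" by blast
    have "\<exists>i. C \<subseteq> insert (Inr i) (Inl ` ?V)"
    proof (cases "\<exists>i. Inr i \<in> C")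
      case True
      then obtain i where i: "Inr i \<in> C" by blast
      have "a \<in> insert (Inr i) (Inl ` ?V)" if a: "a \<in> C" for a
      proof (cases a)
        case (Inl u)
        then show ?thesis using a C by (auto simp: clique_def graph_join_def)
      next
        case (Inr j)
        have "j = i"
        proof (rule ccontr)
          assume "j \<noteq> i"
          then have "(Inr j, Inr i) \<in> parcs ?J" using C a i Inr by (auto simp: clique_def)
          then show False by (auto simp: graph_join_def edgeless_graph_def)
        qed
        then show ?thesis using Inr by simp
      qed
      then show ?thesis by blast
    next
      case False
      have "C \<subseteq> Inl ` ?V"
      proof
        fix a assume "a \<in> C"
        then show "a \<in> Inl ` ?V"
          using C False by (cases a) (auto simp: clique_def graph_join_def)
      qed
      then show ?thesis by blast
    qed
    then obtain i where "C \<subseteq> insert (Inr i) (Inl ` ?V)" by blast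
    then have "card C \<le> card (insert (Inr i) (Inl ` ?V))" using fin by (intro card_mono) auto
    also have "\<dots> \<le> p + 1"
      using p by (simp add: card_insert_if fin card_image)
    finally show "y \<le> p + 1" by (simp add: y)
  next
    have "clique ?J (insert (Inr 0) (Inl ` ?V))"
      using q by (auto simp: clique_def graph_join_def edgeless_graph_def full)
    moreover have "card (insert (Inr 0) (Inl ` ?V)) = p + 1"
      using fin p by (subst card_insert_disjoint) (auto simp: card_image)
    ultimately show "p + 1 \<in> {card C |C. clique ?J C}" by (metis (mono_tags, lifting) mem_Collect_eq)
  qed
qed

section \<open>The inequality and its equality case\<close>

lemma real_choose_two: "real ((k + 1) choose 2) = real k * (real k + 1) / 2"
  by (induction k) (auto simp: numeral_2_eq_2 field_simps)

lemma sum_list_map_add: "(\<Sum>a\<leftarrow>xs. c + a) = real (length xs) * c + sum_list xs"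
  by (induction xs) (auto simp: algebra_simps)

theorem theorem3p3:
  fixes G :: "'a pair_pre_digraph" and p q k :: nat
  assumes "pair_graph G" and "card (pverts G) = p"
    and "q \<ge> p"
    and "1 \<le> k" and "k \<le> p + q - 1"
  defines "J \<equiv> graph_join G (edgeless_graph q)"
  shows "laplacian_sum k J \<le> real (num_edges J) + real ((k + 1) choose 2)
    \<and> (laplacian_sum k J = real (num_edges J) + real ((k + 1) choose 2)
          \<longleftrightarrow> k = p \<and> graph_isomorphic G (complete_graph p))
    \<and> (k = p \<and> graph_isomorphic G (complete_graph p)
          \<longrightarrow> threshold_graph J \<and> clique_number J = k + 1)"
proof -
  note G = \<open>pair_graph G\<close> and p = \<open>card (pverts G) = p\<close> and qp = \<open>q \<ge> p\<close>
    and k = \<open>1 \<le> k\<close> \<open>k \<le> p + q - 1\<close>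
  \<comment> \<open>\<open>q = 0\<close> would force \<open>p = 0\<close>, and then no
    \<open>k\<close> lies in the range.\<close>
  have q: "0 < q" using qp k by linarith
  let ?e = "real (num_edges G)" and ?s = "laplacian_sum k J" and ?iso = "graph_isomorphic G (complete_graph p)"
  have eJ: "real (num_edges J) = ?e + real p * real q"
  proof -
    have "num_edges (edgeless_graph q) = 0" by (simp add: num_edges_def edges_def edgeless_graph_def)
    then show ?thesis
      using num_edges_join[OF G pair_graph_edgeless[of q]] p by (simp add: J_def edgeless_graph_def)
  qed
  have e_le: "2 * ?e \<le> real p * real p - real p" and e_eq: "2 * ?e = real p * real p - real p \<longleftrightarrow> ?iso"
  proof -
    have c: "real (p * p - p) = real p * real p - real p" by (simp add: of_nat_diff)
    have "real (card (parcs G)) \<le> real (p * p - p)"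
      using card_parcs_le[OF G] unfolding p by (rule of_nat_mono)
    then show "2 * ?e \<le> real p * real p - real p" unfolding c by (simp add: card_parcs[OF G])
    have "?iso \<longleftrightarrow> real (card (parcs G)) = real (p * p - p)"
      unfolding graph_isomorphic_complete_iff(1)[OF G p] by (rule of_nat_eq_iff[symmetric])
    then show "2 * ?e = real p * real p - real p \<longleftrightarrow> ?iso"
      unfolding c by (simp add: card_parcs[OF G])
  qed
  have bound: "?s \<le> ?e + real p * real q + real k * (real k + 1) / 2
      \<and> (?s = ?e + real p * real q + real k * (real k + 1) / 2 \<longleftrightarrow> k = p \<and> ?iso)"
  \<comment> \<open>Without vertices in \<open>G\<close> all eigenvalues vanish, while the
    right-hand side is positive because \<open>k \<ge> 1\<close>; so the inequality is strict,
    matching \<open>k \<noteq> p\<close>.\<close>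
  proof (cases "p = 0")
    case True
    then have "pverts G = {}" using p pair_graphD(1)[OF G] by simp
    then have ev: "laplacian_eigenvalues J = replicate q 0"
      unfolding J_def by (intro laplacian_eigenvalues_eqI char_poly_join_edgeless_empty[OF G]) simp_all
    have "?s = 0" using laplacian_sum_eq[of k J] k True by (simp add: ev sum_list_replicate)
    moreover have "0 < real k * (real k + 1) / 2" using k by simp
    moreover have "0 \<le> ?e + real p * real q" by simp
    ultimately have "?s < ?e + real p * real q + real k * (real k + 1) / 2" by linarith
    then show ?thesis using k True by simp
  next
    case False
    then have p0: "0 < p" by simp
    obtain es where es: "char_poly (laplacian G) = (\<Prod>a\<leftarrow>es. [:- a, 1:])" "length es = p"
      "\<And>a. a \<in> set es \<Longrightarrow> 0 \<le> a \<and> a \<le> real p" "sum_list es = 2 * ?e" "0 \<in> set es"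
      using laplacian_spectrum[OF G] p p0 by (metis card.empty less_irrefl)
    define fs where "fs = rev (sort (remove1 0 es))"
    have fs: "mset es = add_mset 0 (mset fs)" using es(5) by (simp add: fs_def)
    have len: "length fs = p - 1" using es(2,5) by (simp add: fs_def length_remove1)
    have range: "0 \<le> a \<and> a \<le> real p" if "a \<in> set fs" for a
      using that es(3) notin_set_remove1 by (force simp: fs_def)
    have sum_fs: "sum_list fs = 2 * ?e"
    proof -
      have "sum_list es = sum_mset (mset es)" by (rule sum_mset_sum_list[symmetric])
      also have "\<dots> = sum_list fs" by (simp add: fs sum_mset_sum_list)
      finally show ?thesis by (simp add: es(4))
    qed
    define E where "E = (real p + real q) # map ((+) (real q)) fs @ replicate (q - 1) (real p) @ [0]"
    have fs_desc: "sorted_wrt (\<lambda>x y. y \<le> x) fs" by (simp add: fs_def sorted_wrt_rev)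
    have "sorted_wrt (\<lambda>x y. y \<le> x) (replicate (q - 1) (real p))"
      by (simp add: sorted_wrt_iff_nth_less)
    moreover have "sorted_wrt (\<lambda>x y. y \<le> x) (map ((+) (real q)) fs)"
      using fs_desc by (simp add: sorted_wrt_map)
    \<comment> \<open>Here \<open>q \<ge> p\<close> fixes the order: shifted eigenvalues lie between
      \<open>q\<close> and \<open>p + q\<close>, hence above the copies of \<open>p\<close>.\<close>
    moreover have "real p \<le> real q + a" "0 \<le> real q + a" "real q + a \<le> real p + real q"
      if "a \<in> set fs" for a
      using range[OF that] qp by auto
    ultimately have "sorted_wrt (\<lambda>x y. y \<le> x) E"
      by (auto simp: E_def sorted_wrt_append)
    then have "sorted (rev E)" by (simp add: sorted_wrt_rev)
    then have ev: "laplacian_eigenvalues J = E"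
      unfolding J_def E_def by (intro laplacian_eigenvalues_eqI char_poly_join_edgeless[OF G p p0 q es(1) fs])
    have s: "?s = sum_list (take k E)"
      using laplacian_sum_eq[of k J] k len p0 q by (simp add: ev E_def)
    show ?thesis
    proof (cases "k < p")
      case True
      let ?S = "sum_list (take (k - 1) fs)"
      have "take k E = (real p + real q) # map ((+) (real q)) (take (k - 1) fs)"
        using True k len by (cases k) (auto simp: E_def take_map)
      then have s': "?s = real p + real k * real q + ?S"
        using True k len by (simp add: s sum_list_map_add of_nat_diff algebra_simps)
      have "?S \<le> sum_list (map (\<lambda>_. real p) (take (k - 1) fs))"
        using sum_list_mono[of "take (k - 1) fs" "\<lambda>a. a" "\<lambda>_. real p"] range in_set_takeD by force
      then have S1: "?S \<le> (real k - 1) * real p"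
        using True k len by (simp add: sum_list_triv of_nat_diff)
      \<comment> \<open>The discarded eigenvalues are nonnegative, so the partial sum is at most the
        trace.\<close>
      have "0 \<le> sum_list (drop (k - 1) fs)"
        using range in_set_dropD by (intro sum_list_nonneg) force
      then have S2: "?S \<le> 2 * ?e"
        using sum_fs sum_list_append[of "take (k - 1) fs" "drop (k - 1) fs"] by simp
      \<comment> \<open>The mean of \<open>S1\<close> and \<open>S2\<close> cancels
        \<open>?e\<close> and leaves the slack \<open>(p - k) * (2 * q - k - 1) / 2\<close>.
        Replacing \<open>q\<close> by \<open>p\<close>, justified by the product
        \<open>(p - k) * (q - p)\<close> below, gives half of this positive product.\<close>
      have "0 < (2 * real p - real k - 1) * (real p - real k)"
        using True k by (intro mult_pos_pos) linarith+
      then have "0 < 2 * real p * real p - 3 * (real p * real k) + real k * real k - real p + real k"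
        by (simp add: algebra_simps)
      moreover have "0 \<le> (real p - real k) * (real q - real p)"
        using True qp by simp
      ultimately have "?s < ?e + real p * real q + real k * (real k + 1) / 2"
        using S1 S2 unfolding s' by (simp add: field_simps)
      then show ?thesis using True by simp
    next
      case False
      \<comment> \<open>The first \<open>k\<close> entries of \<open>E\<close> are the leading one,
        the \<open>p - 1\<close> shifted eigenvalues and \<open>t\<close> copies of
        \<open>p\<close>; \<open>t \<le> q - 1\<close> means that the final 0 is never
        reached.\<close>
      define t where "t = k - p"
      have t: "k = p + t" "t \<le> q - 1" using False k q by (auto simp: t_def)
      have "k = Suc (length fs + t)" using t p0 len by simp
      then have "take k E = (real p + real q) # map ((+) (real q)) fs @ replicate t (real p)"
        using t(2) by (simp add: E_def take_replicate min_absorb1)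
      then have s': "?s = real p + real p * real q + 2 * ?e + real t * real p"
        using len p0 by (simp add: s sum_list_map_add sum_fs sum_list_replicate of_nat_diff algebra_simps)
      show ?thesis
      \<comment> \<open>The gap is exactly \<open>(p * (p - 1) / 2 - ?e) + t * (t + 1) / 2\<close>.
        Both summands are nonnegative; the first vanishes only for complete \<open>G\<close>, the
        second only for \<open>t = 0\<close>.\<close>
      proof (cases "t = 0")
        case True
        then show ?thesis using e_le e_eq t s' by (auto simp: field_simps)
      next
        case False
        then have "0 < real t * (real t + 1)" by simp
        then have "?s < ?e + real p * real q + real k * (real k + 1) / 2"
          using e_le s' by (simp add: t(1) field_simps)
        then show ?thesis using False t by simp
      qed
    qed
  qed
  moreover have "threshold_graph J \<and> clique_number J = k + 1" if "k = p \<and> ?iso"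
    using that join_complete_edgeless[OF G p q] graph_isomorphic_complete_iff(2)[OF G p]
    unfolding J_def by blast
  ultimately show ?thesis unfolding eJ real_choose_two by (simp add: add.assoc)
qed

end
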